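(* Suppose that $0<\epsilon<\frac{1}{\sqrt{17}}$, $0<\delta<\frac{1}{\sqrt{17}}$ and $C\ge 6$. For any positive integer $T<+\infty$ and any integer $d\ge 2$, $$\inf_{A\in\mathcal{A}_{\mathrm{det\text{-}gzr}}}\ \sup_{f\in\mathcal{F}^{\mathrm{Lip}}_{C,d}}\ \min_{t\in\{1,\dots,T\}}\ \mathrm{dist}\Big(0,\partial_\delta f\big(x^{A[f],(t)}\big)\Big)>\epsilon .$$
   Context: Norms are Euclidean. $\mathbb{B}_r(x)=\{v:\|v-x\|\le r\}$ is the closed ball, and $\mathrm{dist}(x,S)=\inf_{v\in S}\|v-x\|$. $\|f\|_{\mathrm{Lip}}$ is the Lipschitz constant of $f$. $\mathrm{supp}(x)=\{i:x_i\ne0\}$, and $e_j$ is the $j$-th standard basis vector. Subdifferentials. For a Lipschitz function $f:\mathbb{R}^n\to\mathbb{R}$, the Clarke subdifferential at $x$ is $\partial f(x)=\mathrm{Conv}\{s:\exists\, x'\to x,\ \nabla f(x')\text{ exists},\ \nabla f(x')\to s\}$. For $\delta\ge 0$, the Goldstein $\delta$-subdifferential at $x$ is $\partial_\delta f(x)=\mathrm{Conv}\big(\bigcup_{y\in\mathbb{B}_\delta(x)}\partial f(y)\big)$. Function class. For $C>0$ and a positive integer $d$, $\mathcal{F}^{\mathrm{Lip}}_{C,d}$ is the set of all $f:\mathbb{R}^{d'}\to\mathbb{R}$ with $d'\in\{1,\dots,d\}$, $\|f\|_{\mathrm{Lip}}\le C$ and $f(0)-\inf_x f(x)\le C$. Local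 oracle. Given $F:\mathbb{R}^n\to\mathbb{R}$ and a query point $x\in\mathbb{R}^n$, a local oracle returns a function $\mathcal{O}_F(x):\mathbb{R}^n\to\mathbb{R}$ for which there exists $\nu>0$ with $F(y)=\mathcal{O}_F(x)(y)$ for all $y\in\mathbb{B}_\nu(x)$. The radius $\nu$ is not returned. Algorithms. An algorithm $A$, applied to a Lipschitz function $F:\mathbb{R}^n\to\mathbb{R}$ ($n$ any positive integer), generates a sequence $\big(x^{A[F],(t)}\big)_{t\ge1}$ of points of $\mathbb{R}^n$. $\mathcal{A}_{\mathrm{det}}$ is the class of deterministic algorithms using only local information at current and past points, i.e. those $A$ such that for all functions $F,G$ on the same $\mathbb{R}^n$ and all integers $t\ge0$: if there exists $\nu>0$ with $\mathcal{O}_F\big(x^{A[F],(i)}\big)(y)=\mathcal{O}_G\big(x^{A[F],(i)}\big)(y)$ for all $i\in\{1,\dots,t\}$ and all $y\in\mathbb{B}_\nu\big(x^{A[F],(i)}\big)$, then $x^{A[F],(j)}=x^{A[G],(j)}$ for all $j\in\{1,\dots,t+1\}$. $\mathcal{A}_{\mathrm{det\text{-}gzr}}\subseteq\mathcal{A}_{\mathrm{det}}$ is the class of deterministic general zero-respecting algorithms: those $A\in\mathcal{A}_{\mathrm{det}}$ such that, for every $F:\mathbb{R}^n\to\mathbb{R}$ and every integer $t\ge1$, writing $x^{(t)}=x^{A[F],(t)}$, $$\mathrm{supp}\big(x^{(t)}\big)\subseteq\bigcup_{i<t}\Big\{j\in\{1,\dots,n\}:\ \forall\nu>0\ \exists\,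 y\in\mathbb{R}^n,\ \theta\in\mathbb{R}\text{ with } y,\ y+\theta e_j\in\mathbb{B}_\nu\big(x^{(i)}\big)\text{ and }F(y)\ne F(y+\theta e_j)\Big\}.$$ (In particular $x^{(1)}=0$, the union being empty for $t=1$.) *)

theory Defs
  imports "HOL-Analysis.Analysis"
begin

text \<open>
  An algorithm acts on functions on \<open>\<real>\<^sup>n\<close> for every dimension \<open>n\<close>, so all the spaces
  \<open>\<real>\<^sup>n\<close> have to live in one type. That type is the inner product space of finitely supported
  real sequences, and \<open>\<real>\<^sup>n\<close> is its subspace of vectors supported on the indices \<open>0, \<dots>, n - 1\<close>
  (so coordinates are counted from 0).
\<close>

typedef fsvec = "{x :: nat \<Rightarrow> real. finite {i. x i \<noteq> 0}}"
  morphisms coord Abs_fsvec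
  by (rule exI[of _ "\<lambda>_. 0"]) simp

setup_lifting type_definition_fsvec

lemma fsvec_eqI: "(\<And>i. coord x i = coord y i) \<Longrightarrow> x = y"
  by (simp add: coord_inject[symmetric] fun_eq_iff)

definition supp :: "fsvec \<Rightarrow> nat set" where
  "supp x = {i. coord x i \<noteq> 0}"

lemma finite_supp [simp]: "finite (supp x)"
  using coord[of x] by (simp add: supp_def)

instantiation fsvec :: real_vector
begin

lift_definition zero_fsvec :: fsvec is "\<lambda>_. 0"
  by simp

lift_definition plus_fsvec :: "fsvec \<Rightarrow> fsvec \<Rightarrow> fsvec" is "\<lambda>x y i. x i + y i"
  subgoal for x y
    by (rule finite_subset[of _ "{i. x i \<noteq> 0} \<union> {i. y i \<noteq> 0}"]) auto
  done

lift_definition minus_fsvec :: "fsvec \<Rightarrow> fsvec \<Rightarrow> fsvec" is "\<lambda>x y i. x i - y i"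
  subgoal for x y
    by (rule finite_subset[of _ "{i. x i \<noteq> 0} \<union> {i. y i \<noteq> 0}"]) auto
  done

lift_definition uminus_fsvec :: "fsvec \<Rightarrow> fsvec" is "\<lambda>x i. - x i"
  by simp

lift_definition scaleR_fsvec :: "real \<Rightarrow> fsvec \<Rightarrow> fsvec" is "\<lambda>c x i. c * x i"
  by (auto intro: finite_subset)

instance
  by standard (transfer; simp add: fun_eq_iff algebra_simps)+

end

lemma coord_simps [simp]:
  "coord 0 i = 0"
  "coord (x + y) i = coord x i + coord y i"
  "coord (x - y) i = coord x i - coord y i"
  "coord (- x) i = - coord x i"
  "coord (c *\<^sub>R x) i = c * coord x i"
  by (transfer; simp)+

instantiation fsvec :: real_inner
begin

definition inner_fsvec :: "fsvec \<Rightarrow> fsvec \<Rightarrow> real" where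
  "inner_fsvec x y = (\<Sum>i\<in>supp x \<inter> supp y. coord x i * coord y i)"

definition norm_fsvec :: "fsvec \<Rightarrow> real" where
  "norm_fsvec x = sqrt (inner x x)"

definition dist_fsvec :: "fsvec \<Rightarrow> fsvec \<Rightarrow> real" where
  "dist_fsvec x y = norm (x - y)"

definition sgn_fsvec :: "fsvec \<Rightarrow> fsvec" where
  "sgn_fsvec x = inverse (norm x) *\<^sub>R x"

definition uniformity_fsvec :: "(fsvec \<times> fsvec) filter" where
  "uniformity_fsvec = (INF e\<in>{0<..}. principal {(x, y). dist x y < e})"

definition open_fsvec :: "fsvec set \<Rightarrow> bool" where
  "open_fsvec U \<longleftrightarrow> (\<forall>x\<in>U. \<forall>\<^sub>F (x', y) in uniformity. x' = x \<longrightarrow> y \<in> U)"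

lemma inner_fsvec_eq:
  assumes "finite I" "supp x \<subseteq> I \<or> supp y \<subseteq> I"
  shows "inner x y = (\<Sum>i\<in>I. coord x i * coord y i)"
  unfolding inner_fsvec_def using assms
  by (intro sum.mono_neutral_left) (auto simp: supp_def)

instance
proof
  fix x y z :: fsvec and r :: real
  show "inner x y = inner y x"
    by (simp add: inner_fsvec_def Int_commute mult.commute)
  show "inner (x + y) z = inner x z + inner y z"
    by (simp add: inner_fsvec_eq[of "supp z"] sum.distrib distrib_right)
  show "inner (r *\<^sub>R x) y = r * inner x y"
    by (simp add: inner_fsvec_eq[of "supp y"] sum_distrib_left mult.assoc)
  show "0 \<le> inner x x"
    by (simp add: inner_fsvec_def sum_nonneg)
  show "inner x x = 0 \<longleftrightarrow> x = 0"
  proof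
    assume "inner x x = 0"
    then have "\<forall>i\<in>supp x. coord x i * coord x i = 0"
      by (simp add: inner_fsvec_def sum_nonneg_eq_0_iff)
    then show "x = 0"
      by (intro fsvec_eqI) (auto simp: supp_def)
  qed (simp add: inner_fsvec_def supp_def)
qed (simp_all add: norm_fsvec_def dist_fsvec_def sgn_fsvec_def uniformity_fsvec_def open_fsvec_def)

end

lift_definition basis_vec :: "nat \<Rightarrow> fsvec" is "\<lambda>j i. if i = j then 1 else 0"
  by simp

lemma coord_basis_vec [simp]: "coord (basis_vec j) i = (if i = j then 1 else 0)"
  by transfer simp

definition Rn :: "nat \<Rightarrow> fsvec set" where
  "Rn n = {x. supp x \<subseteq> {..<n}}"

lemma subspace_Rn: "subspace (Rn n)"
  unfolding subspace_def Rn_def supp_def by (auto simp: subset_iff) force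

lemma inner_Rn:
  assumes "x \<in> Rn n"
  shows "inner x y = (\<Sum>i<n. coord x i * coord y i)"
  using assms by (simp add: Rn_def inner_fsvec_eq)

lemma norm_Rn:
  assumes "x \<in> Rn n"
  shows "norm x = sqrt (\<Sum>i<n. (coord x i)\<^sup>2)"
  using inner_Rn[OF assms, of x] by (simp add: norm_eq_sqrt_inner power2_eq_square)

definition ball_Rn :: "nat \<Rightarrow> real \<Rightarrow> fsvec \<Rightarrow> fsvec set" where
  "ball_Rn n r x = cball x r \<inter> Rn n"

text \<open>
  A function \<open>\<real>\<^sup>n \<rightarrow> \<real>\<close> is represented by a function on \<^typ>\<open>fsvec\<close>. Its values
  outside \<^term>\<open>Rn n\<close> are irrelevant: every notion below looks at values on \<^term>\<open>Rn n\<close> only.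
\<close>

definition lipschitz_Rn :: "nat \<Rightarrow> (fsvec \<Rightarrow> real) \<Rightarrow> bool" where
  "lipschitz_Rn n f \<longleftrightarrow> (\<exists>L. L-lipschitz_on (Rn n) f)"

definition has_gradient :: "nat \<Rightarrow> (fsvec \<Rightarrow> real) \<Rightarrow> fsvec \<Rightarrow> fsvec \<Rightarrow> bool" where
  "has_gradient n f x g \<longleftrightarrow>
     g \<in> Rn n \<and> (f has_derivative (\<lambda>h. inner g h)) (at x within Rn n)"

definition clarke :: "nat \<Rightarrow> (fsvec \<Rightarrow> real) \<Rightarrow> fsvec \<Rightarrow> fsvec set" where
  "clarke n f x = convex hull
     {s \<in> Rn n. \<exists>X G. (\<forall>k. X k \<in> Rn n \<and> has_gradient n f (X k) (G k)) \<and>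
                       X \<longlonglongrightarrow> x \<and> G \<longlonglongrightarrow> s}"

definition goldstein :: "nat \<Rightarrow> real \<Rightarrow> (fsvec \<Rightarrow> real) \<Rightarrow> fsvec \<Rightarrow> fsvec set" where
  "goldstein n \<delta> f x = convex hull (\<Union>y\<in>ball_Rn n \<delta> x. clarke n f y)"

definition lipschitz_class :: "real \<Rightarrow> nat \<Rightarrow> (nat \<times> (fsvec \<Rightarrow> real)) set" where
  "lipschitz_class C d =
     {(n, f). n \<in> {1..d} \<and> C-lipschitz_on (Rn n) f \<and>
              bdd_below (f ` Rn n) \<and> f 0 - (INF x\<in>Rn n. f x) \<le> C}"

text \<open>
  The arguments are the dimension, the function, the query point, and the argument of the
  returned function.
\<close>

type_synonym oracle_map = "nat \<Rightarrow> (fsvec \<Rightarrow> real) \<Rightarrow> fsvec \<Rightarrow> fsvec \<Rightarrow> real"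

definition local_oracle :: "oracle_map \<Rightarrow> bool" where
  "local_oracle \<O> \<longleftrightarrow>
     (\<forall>n\<ge>1. \<forall>F. \<forall>x\<in>Rn n. \<exists>\<nu>>0. \<forall>y\<in>ball_Rn n \<nu> x. F y = \<O> n F x y)"

text \<open>
  \<open>A n F t\<close> is the \<open>t\<close>-th iterate, \<open>t \<ge> 1\<close>, of the algorithm \<open>A\<close> applied to
  \<open>F : \<real>\<^sup>n \<rightarrow> \<real>\<close>. It is meaningful only for Lipschitz \<open>F\<close>, and nothing is required of it for
  other \<open>F\<close>.
\<close>

type_synonym algorithm = "nat \<Rightarrow> (fsvec \<Rightarrow> real) \<Rightarrow> nat \<Rightarrow> fsvec"

definition is_algorithm :: "algorithm \<Rightarrow> bool" where
  "is_algorithm A \<longleftrightarrow> (\<forall>n\<ge>1. \<forall>F. lipschitz_Rn n F \<longrightarrow> (\<forall>t\<ge>1. A n F t \<in> Rn n))"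

definition alg_det :: "oracle_map \<Rightarrow> algorithm set" where
  "alg_det \<O> = {A. is_algorithm A \<and>
     (\<forall>n\<ge>1. \<forall>F G. lipschitz_Rn n F \<longrightarrow> lipschitz_Rn n G \<longrightarrow>
       (\<forall>t. (\<exists>\<nu>>0. \<forall>i\<in>{1..t}. \<forall>y\<in>ball_Rn n \<nu> (A n F i).
                 \<O> n F (A n F i) y = \<O> n G (A n F i) y) \<longrightarrow>
            (\<forall>j\<in>{1..t+1}. A n F j = A n G j)))}"

definition active_coords :: "nat \<Rightarrow> (fsvec \<Rightarrow> real) \<Rightarrow> fsvec \<Rightarrow> nat set" where
  "active_coords n F x =
     {j. j < n \<and> (\<forall>\<nu>>0. \<exists>y\<in>Rn n. \<exists>\<theta>. y \<in> ball_Rn n \<nu> x \<and>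
           y + \<theta> *\<^sub>R basis_vec j \<in> ball_Rn n \<nu> x \<and> F y \<noteq> F (y + \<theta> *\<^sub>R basis_vec j))}"

definition alg_det_gzr :: "oracle_map \<Rightarrow> algorithm set" where
  "alg_det_gzr \<O> = {A \<in> alg_det \<O>.
     \<forall>n\<ge>1. \<forall>F. lipschitz_Rn n F \<longrightarrow>
       (\<forall>t\<ge>1. supp (A n F t) \<subseteq> (\<Union>i\<in>{1..<t}. active_coords n F (A n F i)))}"

end

theory Submission
  imports Defs
begin

text \<open>
  A hard function lives on the plane and comes from a resisting oracle. At every queried point
  \<open>(p, 0)\<close> the function looks like \<open>x\<^sub>1 - p\<close>, so the second coordinate is never active there and a
  zero-respecting algorithm cannot leave the first axis. What the oracle answers at \<open>(p, 0)\<close> depends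
  on \<open>p\<close> only; hence the queries of \<open>T\<close> steps form a finite set of points \<open>(p, 0)\<close>, \<open>p \<in> P\<close>, that
  is the same for all functions with these germs (\<open>queries_confined\<close>).

  It remains to find such a function that is far from stationary around the queried points. The
  function \<open>x\<^sub>2 + \<psi> (x\<^sub>1 - x\<^sub>2)\<close> has derivative exactly 1 along \<open>(1, 1)\<close> whatever \<open>\<psi>\<close> is, and it has the
  germ \<open>x\<^sub>1 - p\<close> at \<open>(p, 0)\<close> as soon as \<open>\<psi> z = z - p\<close> near \<open>p\<close>. A sawtooth \<open>\<psi>\<close> with slopes \<open>\<plusminus>1\<close>
  does this for all \<open>p \<in> P\<close> at once. Cutting the function off at \<open>-1\<close> makes it bounded below, and
  since it is 3-Lipschitz and vanishes at \<open>(p, 0)\<close>, the cut stays away from the \<open>\<delta>\<close>-ball around that point when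
  \<open>3 \<delta> < 1\<close>. So all elements of the Goldstein subdifferential at \<open>(p, 0)\<close> have inner product 1 with
  \<open>(1, 1)\<close> and therefore norm at least \<open>1 / sqrt 2\<close>, which exceeds \<open>1 / sqrt 17\<close>.
\<close>

section \<open>Subgradients and directional derivatives\<close>

lemma inner_basis_vec [simp]: "inner (basis_vec i) x = coord x i"
proof -
  have "inner (basis_vec i) x = (\<Sum>j\<in>{i}. coord (basis_vec i) j * coord x j)"
    by (rule inner_fsvec_eq) (auto simp: supp_def)
  then show ?thesis by simp
qed

lemma abs_coord_le_norm: "\<bar>coord x i\<bar> \<le> norm x"
proof -
  have "norm (basis_vec i) = 1"
    by (simp add: norm_eq_sqrt_inner)
  then show ?thesis
    using Cauchy_Schwarz_ineq2[of "basis_vec i" x] by simp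
qed

lemma basis_vec_in_Rn: "i < n \<Longrightarrow> basis_vec i \<in> Rn n"
  by (auto simp: Rn_def supp_def)

lemma has_gradient_directional:
  assumes grad: "has_gradient n f x g" and x: "x \<in> Rn n" and u: "u \<in> Rn n"
    and lin: "\<forall>\<^sub>F s in at 0. f (x + s *\<^sub>R u) = f x + s * c"
  shows "inner u g = c"
proof -
  have line: "((\<lambda>s. x + s *\<^sub>R u) has_derivative (\<lambda>s. s *\<^sub>R u)) (at 0)"
    by (auto intro!: derivative_eq_intros)
  have sub: "range (\<lambda>s. x + s *\<^sub>R u) \<subseteq> Rn n"
    using x u subspace_Rn by (auto intro: subspace_add subspace_scale)
  have "(f has_derivative inner g) (at (x + 0 *\<^sub>R u) within range (\<lambda>s. x + s *\<^sub>R u))"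
    using grad sub by (auto simp: has_gradient_def intro: has_derivative_subset)
  from has_derivative_in_compose[OF line this]
  have "((\<lambda>s. f (x + s *\<^sub>R u)) has_derivative (\<lambda>s. s * inner g u)) (at 0)"
    by simp
  moreover have "((\<lambda>s. f x + s * c) has_derivative (\<lambda>s. s * c)) (at 0)"
    by (auto intro!: derivative_eq_intros)
  then have "((\<lambda>s. f (x + s *\<^sub>R u)) has_derivative (\<lambda>s. s * c)) (at 0)"
    by (rule has_derivative_transform_eventually)
       (use lin in \<open>auto elim: eventually_mono\<close>)
  ultimately have "(\<lambda>s. s * inner g u) = (\<lambda>s. s * c)"
    by (rule has_derivative_unique)
  from fun_cong[OF this, of 1] show ?thesis
    by (simp add: inner_commute)
qed

text \<open>A hyperplane is closed and convex, so it absorbs the limits and the hull in the definition.\<close>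

lemma clarke_subset_hyperplane:
  assumes "\<forall>\<^sub>F x in nhds y. x \<in> Rn n \<longrightarrow> (\<forall>g. has_gradient n f x g \<longrightarrow> inner u g = c)"
  shows "clarke n f y \<subseteq> {g. inner u g = c}"
  unfolding clarke_def
proof (rule hull_minimal)
  show "convex {g. inner u g = c}"
    by (rule convex_hyperplane)
  show "{s \<in> Rn n. \<exists>X G. (\<forall>k. X k \<in> Rn n \<and> has_gradient n f (X k) (G k)) \<and>
      X \<longlonglongrightarrow> y \<and> G \<longlonglongrightarrow> s} \<subseteq> {g. inner u g = c}"
  proof clarify
    fix s X G
    assume XG: "\<forall>k. X k \<in> Rn n \<and> has_gradient n f (X k) (G k)" and X: "X \<longlonglongrightarrow> y" and G: "G \<longlonglongrightarrow> s"
    have "\<forall>\<^sub>F k in sequentially. inner u (G k) = c"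
      using eventually_compose_filterlim[OF assms X] XG by (auto elim: eventually_mono)
    then have "(\<lambda>k. inner u (G k)) \<longlonglongrightarrow> c"
      by (rule tendsto_eventually)
    moreover have "(\<lambda>k. inner u (G k)) \<longlonglongrightarrow> inner u s"
      by (intro tendsto_intros G)
    ultimately show "inner u s = c"
      by (rule LIMSEQ_unique[symmetric])
  qed
qed

lemma gradient_in_goldstein:
  assumes "has_gradient n f x g" "x \<in> Rn n" "0 \<le> \<delta>"
  shows "g \<in> goldstein n \<delta> f x"
proof -
  have "g \<in> clarke n f x"
    unfolding clarke_def
  proof (intro hull_inc CollectI conjI exI allI)
    show "g \<in> Rn n" "x \<in> Rn n" "has_gradient n f x g"
      using assms by (simp_all add: has_gradient_def)
  qed (rule tendsto_const)+
  moreover have "x \<in> ball_Rn n \<delta> x"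
    using assms by (simp add: ball_Rn_def)
  ultimately show ?thesis
    unfolding goldstein_def by (blast intro: hull_inc)
qed

text \<open>Nonemptiness matters because \<^const>\<open>infdist\<close> to the empty set is 0.\<close>

lemma infdist_hyperplane_ge:
  fixes u :: "'a::real_inner"
  assumes "S \<noteq> {}" "S \<subseteq> {g. inner u g = c}" "u \<noteq> 0"
  shows "c / norm u \<le> infdist 0 S"
  unfolding infdist_notempty[OF assms(1)]
proof (rule cINF_greatest[OF assms(1)])
  fix g assume "g \<in> S"
  then have "c \<le> norm u * norm g"
    using assms(2) norm_cauchy_schwarz[of u g] by auto
  then show "c / norm u \<le> dist 0 g"
    using assms(3) by (simp add: field_simps)
qed

section \<open>The hard function\<close>

abbreviation axis_point :: "real \<Rightarrow> fsvec" where
  "axis_point p \<equiv> p *\<^sub>R basis_vec 0"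

definition diagonal :: fsvec where
  "diagonal = basis_vec 0 + basis_vec 1"

text \<open>
  The peaks of height \<open>r\<close> are at the points \<open>p + r\<close>, so for \<open>r\<close> small against the gaps of \<open>P\<close> the
  rising flank below each of them crosses zero at \<open>p\<close>.
\<close>

definition sawtooth :: "real \<Rightarrow> real set \<Rightarrow> real \<Rightarrow> real" where
  "sawtooth r P z = r - infdist z ((+) r ` P)"

definition diagonal_ramp :: "real \<Rightarrow> real set \<Rightarrow> fsvec \<Rightarrow> real" where
  "diagonal_ramp r P x = coord x 1 + sawtooth r P (coord x 0 - coord x 1)"

definition hard_function :: "real \<Rightarrow> real set \<Rightarrow> fsvec \<Rightarrow> real" where
  "hard_function r P x = max (-1) (diagonal_ramp r P x)"

text \<open>The germs that the resisting oracle reveals.\<close>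

definition axis_germs :: "real set \<Rightarrow> (fsvec \<Rightarrow> real) \<Rightarrow> bool" where
  "axis_germs P F \<longleftrightarrow> (\<forall>p\<in>P. \<exists>\<nu>>0. \<forall>y\<in>ball_Rn 2 \<nu> (axis_point p). F y = coord y 0 - p)"

text \<open>
  The tooth of another point \<open>q\<close> peaks at distance at least \<open>2 * r\<close> from \<open>z\<close>, while \<open>p + r\<close> is
  within \<open>2 * r\<close>; so the nearest peak is \<open>p + r\<close>, and it lies to the right of \<open>z\<close>.
\<close>

lemma sawtooth_near:
  assumes sep: "\<forall>p\<in>P. \<forall>q\<in>P. p \<noteq> q \<longrightarrow> 4 * r \<le> \<bar>p - q\<bar>"
    and p: "p \<in> P" and z: "\<bar>z - p\<bar> \<le> r"
  shows "sawtooth r P z = z - p"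
proof -
  have "infdist z ((+) r ` P) = r - (z - p)"
  proof (rule antisym)
    have "infdist z ((+) r ` P) \<le> dist z (r + p)"
      using p by (intro infdist_le) auto
    also have "\<dots> = r - (z - p)"
      using z by (simp add: dist_real_def)
    finally show "infdist z ((+) r ` P) \<le> r - (z - p)" .
    have "r - (z - p) \<le> dist z (r + q)" if "q \<in> P" for q
    proof (cases "q = p")
      case False
      then have "4 * r \<le> \<bar>p - q\<bar>"
        using sep p that by auto
      then show ?thesis
        using z by (simp add: dist_real_def)
    qed (simp add: dist_real_def)
    then show "r - (z - p) \<le> infdist z ((+) r ` P)"
      using p by (subst infdist_notempty) (auto intro!: cINF_greatest)
  qed
  then show ?thesis
    by (simp add: sawtooth_def)
qed

lemma diagonal_ramp_lipschitz:
  "\<bar>diagonal_ramp r P x - diagonal_ramp r P y\<bar> \<le> 3 * dist x y"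
proof -
  have c: "\<bar>coord x i - coord y i\<bar> \<le> dist x y" for i
    using abs_coord_le_norm[of "x - y" i] by (simp add: dist_norm)
  have "\<bar>infdist (coord x 0 - coord x 1) ((+) r ` P) - infdist (coord y 0 - coord y 1) ((+) r ` P)\<bar>
      \<le> \<bar>(coord x 0 - coord x 1) - (coord y 0 - coord y 1)\<bar>"
    using infdist_triangle_abs[of "coord x 0 - coord x 1" "(+) r ` P" "coord y 0 - coord y 1"]
    by (simp add: dist_real_def)
  then show ?thesis
    using c[of 0] c[of 1] unfolding diagonal_ramp_def sawtooth_def by linarith
qed

lemma hard_function_lipschitz: "3-lipschitz_on X (hard_function r P)"
proof (rule lipschitz_onI)
  fix x y
  show "dist (hard_function r P x) (hard_function r P y) \<le> 3 * dist x y"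
    using diagonal_ramp_lipschitz[of r P x y] by (auto simp: hard_function_def dist_real_def max_def)
qed simp

lemma diagonal_ramp_along_diagonal:
  "diagonal_ramp r P (x + s *\<^sub>R diagonal) = diagonal_ramp r P x + s"
  by (simp add: diagonal_ramp_def diagonal_def)

lemma diagonal_in_Rn: "diagonal \<in> Rn 2"
  unfolding diagonal_def by (intro subspace_add subspace_Rn basis_vec_in_Rn) auto

lemma hard_function_gradient:
  assumes "has_gradient 2 (hard_function r P) x g" "x \<in> Rn 2" "-1 < diagonal_ramp r P x"
  shows "inner diagonal g = 1"
proof (rule has_gradient_directional[OF assms(1,2) diagonal_in_Rn])
  have "((\<lambda>s. diagonal_ramp r P x + s) \<longlongrightarrow> diagonal_ramp r P x + 0) (at 0)"
    by (intro tendsto_intros)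
  then have "\<forall>\<^sub>F s in at 0. -1 < diagonal_ramp r P x + s"
    using assms(3) by (intro order_tendstoD) auto
  then show "\<forall>\<^sub>F s in at 0. hard_function r P (x + s *\<^sub>R diagonal) = hard_function r P x + s * 1"
    by eventually_elim
       (use assms(3) in \<open>simp add: hard_function_def diagonal_ramp_along_diagonal\<close>)
qed

lemma goldstein_hard_function:
  assumes "\<And>y. y \<in> ball_Rn 2 \<delta> x \<Longrightarrow> -1 < diagonal_ramp r P y"
  shows "goldstein 2 \<delta> (hard_function r P) x \<subseteq> {g. inner diagonal g = 1}"
  unfolding goldstein_def
proof (intro hull_minimal UN_least convex_hyperplane)
  fix y assume y: "y \<in> ball_Rn 2 \<delta> x"
  have "3-lipschitz_on UNIV (diagonal_ramp r P)"
    using diagonal_ramp_lipschitz by (auto intro!: lipschitz_onI simp: dist_real_def)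
  then have "isCont (diagonal_ramp r P) y"
    using lipschitz_on_continuous_on continuous_on_eq_continuous_at[OF open_UNIV] by blast
  then have "(diagonal_ramp r P \<longlongrightarrow> diagonal_ramp r P y) (nhds y)"
    by (simp add: isCont_def tendsto_at_iff_tendsto_nhds)
  then have "\<forall>\<^sub>F z in nhds y. -1 < diagonal_ramp r P z"
    by (rule order_tendstoD) (rule assms[OF y])
  then show "clarke 2 (hard_function r P) y \<subseteq> {g. inner diagonal g = 1}"
    by (intro clarke_subset_hyperplane) (auto elim!: eventually_mono intro: hard_function_gradient)
qed

lemma axis_point_in_Rn: "axis_point p \<in> Rn 2"
  by (intro subspace_scale subspace_Rn basis_vec_in_Rn) auto

lemma hard_function_germs:
  assumes sep: "\<forall>p\<in>P. \<forall>q\<in>P. p \<noteq> q \<longrightarrow> 4 * r \<le> \<bar>p - q\<bar>" and r: "0 < r" "r \<le> 1"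
  shows "axis_germs P (hard_function r P)"
  unfolding axis_germs_def
proof (intro ballI exI conjI)
  fix p y assume p: "p \<in> P" and y: "y \<in> ball_Rn 2 (r / 2) (axis_point p)"
  have near: "\<bar>coord (y - axis_point p) i\<bar> \<le> r / 2" for i
    using abs_coord_le_norm[of "y - axis_point p" i] y
    by (simp add: ball_Rn_def dist_norm norm_minus_commute)
  have c0: "\<bar>coord y 0 - p\<bar> \<le> r / 2" and c1: "\<bar>coord y 1\<bar> \<le> r / 2"
    using near[of 0] near[of 1] by simp_all
  have "sawtooth r P (coord y 0 - coord y 1) = coord y 0 - coord y 1 - p"
    by (rule sawtooth_near[OF sep p]) (use c0 c1 in linarith)
  then have "diagonal_ramp r P y = coord y 0 - p"
    by (simp add: diagonal_ramp_def)
  moreover have "-1 \<le> coord y 0 - p"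
    using c0 r by linarith
  ultimately show "hard_function r P y = coord y 0 - p"
    by (simp add: hard_function_def)
qed (use r in auto)

lemma exists_separation:
  fixes P :: "real set"
  assumes "finite P"
  shows "\<exists>r>0. r \<le> 1 \<and> (\<forall>p\<in>P. \<forall>q\<in>P. p \<noteq> q \<longrightarrow> 4 * r \<le> \<bar>p - q\<bar>)"
proof -
  have "finite ((\<lambda>(p, q). p - q) ` (P \<times> P))"
    using assms by simp
  from finite_set_avoid[OF this, of 0] obtain d where d: "d > 0"
    "\<And>p q. p \<in> P \<Longrightarrow> q \<in> P \<Longrightarrow> p \<noteq> q \<Longrightarrow> d \<le> \<bar>p - q\<bar>"
    by (auto simp: dist_real_def)
  show ?thesis
    by (rule exI[of _ "min 1 (d / 4)"]) (use d in \<open>fastforce simp: min_def\<close>)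
qed

lemma axis_germs_gradient:
  assumes "axis_germs P F" "p \<in> P"
  shows "has_gradient 2 F (axis_point p) (basis_vec 0)"
proof -
  obtain \<nu> where \<nu>: "\<nu> > 0" "\<And>y. y \<in> ball_Rn 2 \<nu> (axis_point p) \<Longrightarrow> F y = coord y 0 - p"
    using assms by (auto simp: axis_germs_def)
  have "((\<lambda>y. inner (basis_vec 0) y - p) has_derivative inner (basis_vec 0))
      (at (axis_point p) within Rn 2)"
    using has_derivative_diff[OF bounded_linear_imp_has_derivative[OF bounded_linear_inner_right]
        has_derivative_const, of "basis_vec 0"]
    by (simp del: inner_basis_vec)
  then have "(F has_derivative inner (basis_vec 0)) (at (axis_point p) within Rn 2)"
    by (rule has_derivative_transform_within[OF _ \<nu>(1) axis_point_in_Rn])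
       (simp add: \<nu>(2) ball_Rn_def dist_commute)
  then show ?thesis
    by (simp add: has_gradient_def basis_vec_in_Rn del: inner_basis_vec)
qed

lemma infdist_goldstein_hard_function:
  assumes germs: "axis_germs P (hard_function r P)" and p: "p \<in> P" and \<delta>: "0 \<le> \<delta>" "3 * \<delta> < 1"
  shows "1 / sqrt 2 \<le> infdist 0 (goldstein 2 \<delta> (hard_function r P) (axis_point p))"
proof -
  have "axis_point p \<in> ball_Rn 2 \<nu> (axis_point p)" if "\<nu> > 0" for \<nu>
    using that axis_point_in_Rn by (simp add: ball_Rn_def)
  then have "hard_function r P (axis_point p) = 0"
    using germs p by (force simp: axis_germs_def)
  then have centre: "diagonal_ramp r P (axis_point p) = 0"
    by (auto simp: hard_function_def max_def split: if_splits)
  have "-1 < diagonal_ramp r P y" if "y \<in> ball_Rn 2 \<delta> (axis_point p)" for y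
    using diagonal_ramp_lipschitz[of r P "axis_point p" y] that \<delta> by (auto simp: ball_Rn_def centre)
  then have "goldstein 2 \<delta> (hard_function r P) (axis_point p) \<subseteq> {g. inner diagonal g = 1}"
    by (rule goldstein_hard_function)
  moreover have "goldstein 2 \<delta> (hard_function r P) (axis_point p) \<noteq> {}"
    using gradient_in_goldstein[OF axis_germs_gradient[OF germs p] axis_point_in_Rn \<delta>(1)] by auto
  moreover have "norm diagonal = sqrt 2"
    by (simp add: norm_eq_sqrt_inner inner_add_left diagonal_def)
  moreover from this have "diagonal \<noteq> 0"
    by force
  ultimately show ?thesis
    using infdist_hyperplane_ge by metis
qed

lemma hard_function_in_class:
  assumes "r \<le> 1" "0 \<le> r" "3 \<le> C" "2 \<le> d"
  shows "(2, hard_function r P) \<in> lipschitz_class C d"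
proof -
  have bdd: "bdd_below (hard_function r P ` Rn 2)"
    by (rule bdd_belowI[of _ "-1"]) (auto simp: hard_function_def)
  have "Rn 2 \<noteq> {}"
    using axis_point_in_Rn by blast
  then have "-1 \<le> (INF x\<in>Rn 2. hard_function r P x)"
    by (rule cINF_greatest) (simp add: hard_function_def)
  moreover have "hard_function r P 0 \<le> r"
    using infdist_nonneg[of 0 "(+) r ` P"] assms
    by (auto simp: hard_function_def diagonal_ramp_def sawtooth_def)
  moreover have "C-lipschitz_on (Rn 2) (hard_function r P)"
    using lipschitz_on_mono[OF hard_function_lipschitz subset_UNIV assms(3)] by auto
  ultimately show ?thesis
    using assms bdd by (auto simp: lipschitz_class_def)
qed

section \<open>The resisting oracle\<close>

lemma active_coords_axis:
  assumes "axis_germs P F" "p \<in> P"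
  shows "active_coords 2 F (axis_point p) \<subseteq> {0}"
proof
  fix j assume j: "j \<in> active_coords 2 F (axis_point p)"
  obtain \<nu> where \<nu>: "\<nu> > 0" "\<And>y. y \<in> ball_Rn 2 \<nu> (axis_point p) \<Longrightarrow> F y = coord y 0 - p"
    using assms by (auto simp: axis_germs_def)
  from j \<nu>(1) obtain y \<theta> where "y \<in> ball_Rn 2 \<nu> (axis_point p)"
    "y + \<theta> *\<^sub>R basis_vec j \<in> ball_Rn 2 \<nu> (axis_point p)" "F y \<noteq> F (y + \<theta> *\<^sub>R basis_vec j)"
    unfolding active_coords_def by blast
  then show "j \<in> {0}"
    using \<nu>(2) by (auto split: if_splits)
qed

lemma local_oracle_agree:
  assumes "local_oracle \<O>" "axis_germs P F" "axis_germs P G" "p \<in> P"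
  shows "\<exists>\<nu>>0. \<forall>y\<in>ball_Rn 2 \<nu> (axis_point p). \<O> 2 F (axis_point p) y = \<O> 2 G (axis_point p) y"
proof -
  obtain a where a: "a > 0" "\<forall>y\<in>ball_Rn 2 a (axis_point p). F y = coord y 0 - p"
    using assms(2,4) by (auto simp: axis_germs_def)
  obtain b where b: "b > 0" "\<forall>y\<in>ball_Rn 2 b (axis_point p). G y = coord y 0 - p"
    using assms(3,4) by (auto simp: axis_germs_def)
  have orc: "\<exists>\<nu>>0. \<forall>y\<in>ball_Rn 2 \<nu> (axis_point p). H y = \<O> 2 H (axis_point p) y" for H
    using assms(1) axis_point_in_Rn[of p] unfolding local_oracle_def by simp
  obtain c where c: "c > 0" "\<forall>y\<in>ball_Rn 2 c (axis_point p). F y = \<O> 2 F (axis_point p) y"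
    using orc by blast
  obtain e where e: "e > 0" "\<forall>y\<in>ball_Rn 2 e (axis_point p). G y = \<O> 2 G (axis_point p) y"
    using orc by blast
  show ?thesis
  proof (intro exI conjI ballI)
    show "0 < min (min a b) (min c e)"
      using a b c e by simp
  next
    fix y assume "y \<in> ball_Rn 2 (min (min a b) (min c e)) (axis_point p)"
    then have "y \<in> ball_Rn 2 a (axis_point p)" "y \<in> ball_Rn 2 b (axis_point p)"
      "y \<in> ball_Rn 2 c (axis_point p)" "y \<in> ball_Rn 2 e (axis_point p)"
      by (simp_all add: ball_Rn_def)
    then show "\<O> 2 F (axis_point p) y = \<O> 2 G (axis_point p) y"
      using a(2) b(2) c(2) e(2) by metis
  qed
qed

lemma alg_det_iterates_agree:
  assumes "A \<in> alg_det \<O>" "n \<ge> 1" "lipschitz_Rn n F" "lipschitz_Rn n G"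
    and "\<exists>\<nu>>0. \<forall>i\<in>{1..t}. \<forall>y\<in>ball_Rn n \<nu> (A n F i). \<O> n F (A n F i) y = \<O> n G (A n F i) y"
    and "j \<in> {1..t + 1}"
  shows "A n F j = A n G j"
  using assms unfolding alg_det_def by blast

lemma common_radius:
  fixes x :: "'a \<Rightarrow> fsvec"
  assumes "finite I" "\<And>i. i \<in> I \<Longrightarrow> \<exists>\<nu>>0. \<forall>y\<in>ball_Rn n \<nu> (x i). Q i y"
  shows "\<exists>\<nu>>0. \<forall>i\<in>I. \<forall>y\<in>ball_Rn n \<nu> (x i). Q i y"
  using assms
proof (induction I rule: finite_induct)
  case empty
  show ?case by (rule exI[of _ 1]) simp
next
  case (insert i I)
  obtain \<nu> where \<nu>: "\<nu> > 0" "\<forall>i\<in>I. \<forall>y\<in>ball_Rn n \<nu> (x i). Q i y"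
    using insert by auto
  obtain \<mu> where \<mu>: "\<mu> > 0" "\<forall>y\<in>ball_Rn n \<mu> (x i). Q i y"
    using insert.prems by auto
  show ?case
    by (rule exI[of _ "min \<mu> \<nu>"]) (use \<nu> \<mu> in \<open>auto simp: ball_Rn_def\<close>)
qed

text \<open>
  In the induction step the next query is read off from a run on one hard function \<open>G\<close> with the
  germs planned so far; determinism carries it over to all functions with these germs,
  in particular to those that have the right germ at the new point as well.
\<close>

lemma queries_confined:
  assumes orc: "local_oracle \<O>" and A: "A \<in> alg_det_gzr \<O>"
  shows "\<exists>P. finite P \<and> (\<forall>F. lipschitz_Rn 2 F \<longrightarrow> axis_germs P F \<longrightarrow>
           (\<forall>t\<in>{1..T}. A 2 F t \<in> axis_point ` P))"
proof (induction T)
  case 0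
  show ?case by (intro exI[of _ "{}"]) simp
next
  case (Suc T)
  have det: "A \<in> alg_det \<O>"
    using A by (simp add: alg_det_gzr_def)
  from Suc obtain P where P: "finite P"
    and conf: "\<And>F t. lipschitz_Rn 2 F \<Longrightarrow> axis_germs P F \<Longrightarrow> t \<in> {1..T} \<Longrightarrow> A 2 F t \<in> axis_point ` P"
    by blast
  obtain r where "r > 0" "r \<le> 1" "\<forall>p\<in>P. \<forall>q\<in>P. p \<noteq> q \<longrightarrow> 4 * r \<le> \<bar>p - q\<bar>"
    using exists_separation[OF P] by blast
  then obtain G where G: "lipschitz_Rn 2 G" "axis_germs P G"
    using hard_function_germs hard_function_lipschitz unfolding lipschitz_Rn_def by metis
  have "supp (A 2 G (Suc T)) \<subseteq> (\<Union>i\<in>{1..<Suc T}. active_coords 2 G (A 2 G i))"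
    using A G(1) unfolding alg_det_gzr_def by auto
  also have "\<dots> \<subseteq> {0}"
    using conf[OF G] active_coords_axis[OF G(2)] by (fastforce simp: less_Suc_eq_le)
  finally have next_query: "A 2 G (Suc T) = axis_point (coord (A 2 G (Suc T)) 0)"
    by (intro fsvec_eqI) (auto simp: supp_def)
  define q where "q = coord (A 2 G (Suc T)) 0"
  have "A 2 F t \<in> axis_point ` insert q P"
    if F: "lipschitz_Rn 2 F" "axis_germs (insert q P) F" and t: "t \<in> {1..Suc T}" for F t
  proof -
    have FP: "axis_germs P F"
      using F(2) by (simp add: axis_germs_def)
    have "\<exists>\<nu>>0. \<forall>y\<in>ball_Rn 2 \<nu> (A 2 G i). \<O> 2 G (A 2 G i) y = \<O> 2 F (A 2 G i) y"
      if i: "i \<in> {1..T}" for i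
    proof -
      obtain p where "p \<in> P" "A 2 G i = axis_point p"
        using conf[OF G i] by blast
      then show ?thesis
        using local_oracle_agree[OF orc G(2) FP] by simp
    qed
    then have "\<exists>\<nu>>0. \<forall>i\<in>{1..T}. \<forall>y\<in>ball_Rn 2 \<nu> (A 2 G i). \<O> 2 G (A 2 G i) y = \<O> 2 F (A 2 G i) y"
      by (intro common_radius) auto
    then have eq: "A 2 F t = A 2 G t"
      using alg_det_iterates_agree[OF det _ G(1) F(1), of T t] t by simp
    show ?thesis
    proof (cases "t = Suc T")
      case True
      then show ?thesis
        using eq next_query by (simp add: q_def)
    next
      case False
      then show ?thesis
        using eq conf[OF G, of t] t by auto
    qed
  qed
  then show ?case
    using P by (intro exI[of _ "insert q P"]) blast
qed

section \<open>The lower bound\<close>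

theorem theorem3p5:
  fixes \<epsilon> \<delta> C :: real and T d :: nat and \<O> :: oracle_map
  assumes "local_oracle \<O>"
    and "0 < \<epsilon>" "\<epsilon> < 1 / sqrt 17"
    and "0 < \<delta>" "\<delta> < 1 / sqrt 17"
    and "C \<ge> 6"
    and "T \<ge> 1"
    and "d \<ge> 2"
  shows "(INF A\<in>alg_det_gzr \<O>. SUP (n, f)\<in>lipschitz_class C d.
           ereal (MIN t\<in>{1..T}. infdist 0 (goldstein n \<delta> f (A n f t)))) > ereal \<epsilon>"
proof -
  have "1 / sqrt 17 < (1 :: real) / sqrt 2"
    by (intro divide_strict_left_mono) auto
  then have "ereal \<epsilon> < ereal (1 / sqrt 2)"
    using assms(3) by simp
  also have "\<dots> \<le> (INF A\<in>alg_det_gzr \<O>. SUP (n, f)\<in>lipschitz_class C d.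
           ereal (MIN t\<in>{1..T}. infdist 0 (goldstein n \<delta> f (A n f t))))"
  proof (rule INF_greatest)
    fix A assume A: "A \<in> alg_det_gzr \<O>"
    obtain P where P: "finite P" and conf: "\<And>F t. lipschitz_Rn 2 F \<Longrightarrow> axis_germs P F \<Longrightarrow>
        t \<in> {1..T} \<Longrightarrow> A 2 F t \<in> axis_point ` P"
      using queries_confined[OF assms(1) A, of T] by blast
    obtain r where r: "r > 0" "r \<le> 1" "\<forall>p\<in>P. \<forall>q\<in>P. p \<noteq> q \<longrightarrow> 4 * r \<le> \<bar>p - q\<bar>"
      using exists_separation[OF P] by blast
    let ?f = "hard_function r P"
    have germs: "axis_germs P ?f"
      using hard_function_germs r by blast
    have lip: "lipschitz_Rn 2 ?f"
      using hard_function_lipschitz by (auto simp: lipschitz_Rn_def)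
    have "3 < sqrt 17"
      by (rule real_less_rsqrt) simp
    then have "1 / sqrt 17 < 1 / 3"
      by (intro divide_strict_left_mono) auto
    then have \<delta>: "3 * \<delta> < 1"
      using assms(5) by linarith
    have "1 / sqrt 2 \<le> infdist 0 (goldstein 2 \<delta> ?f (A 2 ?f t))" if t: "t \<in> {1..T}" for t
    proof -
      obtain p where "p \<in> P" "A 2 ?f t = axis_point p"
        using conf[OF lip germs t] by blast
      then show ?thesis
        using infdist_goldstein_hard_function[OF germs _ _ \<delta>] assms(4) by simp
    qed
    then have "1 / sqrt 2 \<le> (MIN t\<in>{1..T}. infdist 0 (goldstein 2 \<delta> ?f (A 2 ?f t)))"
      using assms(7) by (intro Min.boundedI) auto
    moreover have "(2, ?f) \<in> lipschitz_class C d"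
      using r assms by (intro hard_function_in_class) auto
    ultimately show "ereal (1 / sqrt 2) \<le> (SUP (n, f)\<in>lipschitz_class C d.
           ereal (MIN t\<in>{1..T}. infdist 0 (goldstein n \<delta> f (A n f t))))"
      by (intro SUP_upper2[of "(2, ?f)"]) auto
  qed
  finally show ?thesis .
qed

end
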